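(* Let $\mathcal A$ be a unital $C^*$-algebra and $L$ a partially-defined $L$-seminorm on $\mathcal A$. Then $$\sup_\alpha \mathrm{diam}(S(\mathcal A_\alpha))=\mathrm{diam}(S(\mathcal A))=\mathrm{diam}(QS(\mathcal A)),$$ where $\alpha$ parametrizes all maximal unital commutative $C^*$-subalgebras $\mathcal A_\alpha$ of $\mathcal A$.
   Context: $\mathcal A^{sa}$ is the set of self-adjoint elements of $\mathcal A$; $S(\cdot)$ is the state space. Unital commutative $C^*$-subalgebras of $\mathcal A$ contain the unit of $\mathcal A$. A quasi-state on $\mathcal A$ is a map $\mu:\mathcal A\to\mathbb C$ that is linear on every unital commutative $C^*$-subalgebra, satisfies $\mu(a+ib)=\mu(a)+i\mu(b)$ for $a,b\in\mathcal A^{sa}$, $\mu(a^*a)\ge0$ for all $a\in\mathcal A$, and $\mu(1)=1$; $QS(\mathcal A)$ is the set of quasi-states. A partially-defined $L$-seminorm on $\mathcal A$ is a map $L:\mathcal A^{sa}\to[0,+\infty]$ with $L(af)=|a|L(f)$ for $a\in\mathbb R$ (with $0\cdot\infty=0$), $L(f+g)\le L(f)+L(g)$, $L(1)=0$. For $\mu,\nu\in QS(\mathcal A)$: $d_L(\mu,\nu):=\sup\{|\mu(f)-\nu(f)|:f\in\mathcal A^{sa},L(f)\le1\}\in[0,\infty]$. For $\mu_\alpha,\nu_\alpha\in S(\mathcal A_\alpha)$: $d_{L,\alpha}(\mu_\alpha,\nu_\alpha):=\sup\{|\mu_\alpha(f)-\nu_\alpha(f)|:f\in\mathcal A_\alpha^{sa},L(f)\le1\}$.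 The diameters (in $[0,\infty]$) are $\mathrm{diam}(QS(\mathcal A)):=\sup\{d_L(\mu,\nu):\mu,\nu\in QS(\mathcal A)\}$, $\mathrm{diam}(S(\mathcal A)):=\sup\{d_L(\mu,\nu):\mu,\nu\in S(\mathcal A)\}$, $\mathrm{diam}(S(\mathcal A_\alpha)):=\sup\{d_{L,\alpha}(\mu_\alpha,\nu_\alpha):\mu_\alpha,\nu_\alpha\in S(\mathcal A_\alpha)\}$. *)

theory Defs
  imports "HOL-Analysis.Analysis"
begin

text \<open>
  The superclass \<open>banach\<close> gives completeness, and \<open>real_normed_algebra_1\<close> gives
  submultiplicativity and \<open>norm 1 = 1\<close> (so \<open>1 \<noteq> 0\<close>); \<open>scaleR_scaleC\<close> makes the complex
  scalar multiplication extend the real one.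
\<close>

class unital_cstar_algebra = real_normed_algebra_1 + banach +
  fixes scaleC :: "complex \<Rightarrow> 'a \<Rightarrow> 'a" (infixr "*\<^sub>C" 75)
    and star :: "'a \<Rightarrow> 'a"
  assumes scaleC_add_right: "c *\<^sub>C (x + y) = c *\<^sub>C x + c *\<^sub>C y"
    and scaleC_add_left: "(c + d) *\<^sub>C x = c *\<^sub>C x + d *\<^sub>C x"
    and scaleC_scaleC: "c *\<^sub>C (d *\<^sub>C x) = (c * d) *\<^sub>C x"
    and scaleR_scaleC: "r *\<^sub>R x = complex_of_real r *\<^sub>C x"
    and mult_scaleC_left: "(c *\<^sub>C x) * y = c *\<^sub>C (x * y)"
    and mult_scaleC_right: "x * (c *\<^sub>C y) = c *\<^sub>C (x * y)"
    and norm_scaleC: "norm (c *\<^sub>C x) = cmod c * norm x"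
    and star_star: "star (star x) = x"
    and star_add: "star (x + y) = star x + star y"
    and star_scaleC: "star (c *\<^sub>C x) = cnj c *\<^sub>C star x"
    and star_mult: "star (x * y) = star y * star x"
    and cstar_identity: "norm (star x * x) = (norm x)\<^sup>2"

definition self_adjoint :: "'a::unital_cstar_algebra \<Rightarrow> bool" where
  "self_adjoint a \<longleftrightarrow> star a = a"

definition unital_cstar_subalgebra :: "'a::unital_cstar_algebra set \<Rightarrow> bool" where
  "unital_cstar_subalgebra B \<longleftrightarrow>
     1 \<in> B \<and>
     (\<forall>x\<in>B. \<forall>y\<in>B. x + y \<in> B) \<and>
     (\<forall>c. \<forall>x\<in>B. c *\<^sub>C x \<in> B) \<and>
     (\<forall>x\<in>B. \<forall>y\<in>B. x * y \<in> B) \<and>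
     (\<forall>x\<in>B. star x \<in> B) \<and>
     closed B"

definition unital_comm_cstar_subalgebra :: "'a::unital_cstar_algebra set \<Rightarrow> bool" where
  "unital_comm_cstar_subalgebra B \<longleftrightarrow>
     unital_cstar_subalgebra B \<and> (\<forall>x\<in>B. \<forall>y\<in>B. x * y = y * x)"

definition maximal_unital_comm_cstar_subalgebra :: "'a::unital_cstar_algebra set \<Rightarrow> bool" where
  "maximal_unital_comm_cstar_subalgebra B \<longleftrightarrow>
     unital_comm_cstar_subalgebra B \<and>
     (\<forall>C. unital_comm_cstar_subalgebra C \<and> B \<subseteq> C \<longrightarrow> C = B)"

definition complex_linear_on ::
    "'a::unital_cstar_algebra set \<Rightarrow> ('a \<Rightarrow> complex) \<Rightarrow> bool" where
  "complex_linear_on B \<mu> \<longleftrightarrow>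
     (\<forall>x\<in>B. \<forall>y\<in>B. \<mu> (x + y) = \<mu> x + \<mu> y) \<and>
     (\<forall>c. \<forall>x\<in>B. \<mu> (c *\<^sub>C x) = c * \<mu> x)"

text \<open>
  The state space \<open>S(B)\<close> of a unital C*-subalgebra \<open>B\<close>. A map on \<open>B\<close> is represented by
  an extensional function (\<open>undefined\<close> outside \<open>B\<close>), so \<open>states UNIV\<close> is the state space
  of the whole algebra.
\<close>

definition states :: "'a::unital_cstar_algebra set \<Rightarrow> ('a \<Rightarrow> complex) set" where
  "states B = {\<mu> \<in> extensional B.
     complex_linear_on B \<mu> \<and>
     (\<forall>a\<in>B. \<mu> (star a * a) \<in> \<real>\<^sub>\<ge>\<^sub>0) \<and>
     \<mu> 1 = 1}"

definition quasi_states :: "('a::unital_cstar_algebra \<Rightarrow> complex) set" where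
  "quasi_states = {\<mu>.
     (\<forall>B. unital_comm_cstar_subalgebra B \<longrightarrow> complex_linear_on B \<mu>) \<and>
     (\<forall>a b. self_adjoint a \<and> self_adjoint b \<longrightarrow> \<mu> (a + \<i> *\<^sub>C b) = \<mu> a + \<i> * \<mu> b) \<and>
     (\<forall>a. \<mu> (star a * a) \<in> \<real>\<^sub>\<ge>\<^sub>0) \<and>
     \<mu> 1 = 1}"

text \<open>
  Only the values of \<open>L\<close> on self-adjoint elements are meaningful. In \<open>ennreal\<close> one has
  \<open>0 * \<infinity> = 0\<close>.
\<close>

definition partially_defined_L_seminorm :: "('a::unital_cstar_algebra \<Rightarrow> ennreal) \<Rightarrow> bool" where
  "partially_defined_L_seminorm L \<longleftrightarrow>
     (\<forall>r f. self_adjoint f \<longrightarrow> L (r *\<^sub>R f) = ennreal \<bar>r\<bar> * L f) \<and>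
     (\<forall>f g. self_adjoint f \<and> self_adjoint g \<longrightarrow> L (f + g) \<le> L f + L g) \<and>
     L 1 = 0"

text \<open>
  \<open>L_dist L UNIV\<close> is \<open>d\<^sub>L\<close>, and for a subalgebra \<open>B\<close>, \<open>L_dist L B\<close> is the corresponding
  distance on \<open>S(B)\<close>. Suprema are taken in \<open>[0, \<infinity>]\<close>, where the empty one is \<open>0\<close>.
\<close>

definition L_dist :: "('a::unital_cstar_algebra \<Rightarrow> ennreal) \<Rightarrow> 'a set \<Rightarrow>
    ('a \<Rightarrow> complex) \<Rightarrow> ('a \<Rightarrow> complex) \<Rightarrow> ennreal" where
  "L_dist L B \<mu> \<nu> =
     (SUP f\<in>{f \<in> B. self_adjoint f \<and> L f \<le> 1}. ennreal (cmod (\<mu> f - \<nu> f)))"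

definition L_diam :: "('a::unital_cstar_algebra \<Rightarrow> ennreal) \<Rightarrow> 'a set \<Rightarrow>
    ('a \<Rightarrow> complex) set \<Rightarrow> ennreal" where
  "L_diam L B X = (SUP \<mu>\<in>X. SUP \<nu>\<in>X. L_dist L B \<mu> \<nu>)"

end

theory Submission
  imports Defs
begin

text \<open>
  A self-adjoint \<open>f\<close> lies in some maximal commutative subalgebra, to which quasi-states restrict
  as states; this gives \<open>diam QS \<le> sup\<^sub>\<alpha> diam S\<^sub>\<alpha>\<close>. Conversely, for a state \<open>\<mu>\<close> on a subalgebra
  containing \<open>f\<close>, the Hahn--Banach theorem gives a contractive unital functional \<open>\<phi>\<close> on the whole
  algebra with \<open>\<phi> f \<ge> \<mu> f\<close>. Such a \<open>\<phi>\<close> is a state because every \<open>star a * a\<close> lies in a ball of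
  radius \<open>s\<close> around \<open>s\<close>. The last fact is Kaplansky's theorem; in place of the spectrum its proof
  uses square roots given by a power series.
\<close>

subsection \<open>The Hahn--Banach theorem for sublinear functionals\<close>

text \<open>A distance between states on a subalgebra compares the two numbers
  \<open>\<mu> f\<close> and \<open>\<nu> f\<close> for one \<open>f\<close> at a time. It is
  therefore enough to find one global state whose value at \<open>f\<close> is at least
  \<open>\<mu> f\<close> and another whose value is at most \<open>\<nu> f\<close>; the gap can only
  widen. Balls enter because a real functional \<open>\<phi>\<close> below the norm with
  \<open>\<phi> 1 = 1\<close> satisfies s - \<phi>(h) = \<phi>(s 1 - h) \<le> s, hence \<phi>(h)
  \<ge> 0, whenever h lies in the ball of radius s around s 1. By the triangle inequality this
  criterion is stable under sums, and the series of sqrt(1 - y) gives every self-adjoint element of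
  such a ball a root that again satisfies it. The obstacle is to exclude a negative part of
  \<open>star a * a\<close>. Two facts prepare this: the positive cone meets its negative only in 0,
  and commuting positive roots of the same element agree. The chain of inequalities closes up
  because every state is a quasi-state.\<close>

definition sublinear :: "('v::real_vector \<Rightarrow> real) \<Rightarrow> bool" where
  "sublinear q \<longleftrightarrow> (\<forall>x y. q (x + y) \<le> q x + q y) \<and> (\<forall>r\<ge>0. \<forall>x. q (r *\<^sub>R x) = r * q x)"

lemma sublinear_add: "sublinear q \<Longrightarrow> q (x + y) \<le> q x + q y"
  and sublinear_scale: "sublinear q \<Longrightarrow> r \<ge> 0 \<Longrightarrow> q (r *\<^sub>R x) = r * q x"
  unfolding sublinear_def by blast+

lemma sublinear_zero: "sublinear q \<Longrightarrow> q 0 = 0"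
  using sublinear_scale[of q 0 0] by simp

lemma sublinear_ge_uminus: "sublinear q \<Longrightarrow> - q (- x) \<le> q x"
  using sublinear_add[of q x "- x"] sublinear_zero[of q] by simp

lemma sublinearI:
  assumes add: "\<And>x y. q (x + y) \<le> q x + q y" and zero: "q 0 = 0"
    and scale: "\<And>r x. r > 0 \<Longrightarrow> q (r *\<^sub>R x) \<le> r * q x"
  shows "sublinear q"
proof -
  have "q (r *\<^sub>R x) = r * q x" if "r \<ge> 0" for r x
  proof (cases "r = 0")
    case False
    then have r: "r > 0" using that by simp
    have "q ((1 / r) *\<^sub>R (r *\<^sub>R x)) \<le> (1 / r) * q (r *\<^sub>R x)"
      using r by (intro scale) simp
    then have "r * q x \<le> q (r *\<^sub>R x)" using r by (simp add: field_simps)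
    then show ?thesis using scale[OF r, of x] by simp
  qed (simp add: zero)
  then show ?thesis using add by (simp add: sublinear_def)
qed

text \<open>The infimum of q(x + t y) - t q(y) over t \<ge> 0 is the largest sublinear functional
  below \<open>q\<close> whose value at \<open>- y\<close> is at most \<open>- q y\<close>. Every
  linear functional below it takes exactly the value \<open>q y\<close> at \<open>y\<close>. The
  last clause retains lower bounds at other points.\<close>

lemma sublinear_contract:
  assumes q: "sublinear (q :: 'v::real_vector \<Rightarrow> real)"
  obtains q' where "sublinear q'" "\<And>x. q' x \<le> q x" "q' (- y) \<le> - q y"
    "\<And>x c. (\<And>t. t \<ge> 0 \<Longrightarrow> c \<le> q (x + t *\<^sub>R y) - t * q y) \<Longrightarrow> c \<le> q' x"
proof -
  define q' where "q' x = (INF t\<in>{0..}. q (x + t *\<^sub>R y) - t * q y)" for x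
  have bdd: "bdd_below ((\<lambda>t. q (x + t *\<^sub>R y) - t * q y) ` {0..})" for x
  proof (rule bdd_belowI2)
    fix t :: real assume "t \<in> {0..}"
    then have "t * q y = q ((x + t *\<^sub>R y) + (- x))" using sublinear_scale[OF q, of t y] by simp
    also have "\<dots> \<le> q (x + t *\<^sub>R y) + q (- x)" by (rule sublinear_add[OF q])
    finally show "- q (- x) \<le> q (x + t *\<^sub>R y) - t * q y" by simp
  qed
  have le: "q' x \<le> q (x + t *\<^sub>R y) - t * q y" if "t \<ge> 0" for x t
    unfolding q'_def using that by (intro cINF_lower bdd) simp
  have ge: "c \<le> q' x" if "\<And>t. t \<ge> 0 \<Longrightarrow> c \<le> q (x + t *\<^sub>R y) - t * q y" for x c
    unfolding q'_def using that by (intro cINF_greatest) auto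
  have le0: "q' x \<le> q x" for x using le[of 0 x] by simp
  have "sublinear q'"
  proof (rule sublinearI)
    fix x z
    have 1: "q' (x + z) - (q (x + t *\<^sub>R y) - t * q y) \<le> q (z + t' *\<^sub>R y) - t' * q y"
      if t: "t \<ge> 0" "t' \<ge> 0" for t t'
    proof -
      have "q' (x + z) \<le> q ((x + t *\<^sub>R y) + (z + t' *\<^sub>R y)) - (t + t') * q y"
        using le[of "t + t'" "x + z"] t by (simp add: algebra_simps)
      also have "\<dots> \<le> q (x + t *\<^sub>R y) + q (z + t' *\<^sub>R y) - (t + t') * q y"
        using sublinear_add[OF q] by simp
      finally show ?thesis by (simp add: algebra_simps)
    qed
    have "q' (x + z) - (q (x + t *\<^sub>R y) - t * q y) \<le> q' z" if "t \<ge> 0" for t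
      by (rule ge) (use 1 that in auto)
    then have "q' (x + z) - q' z \<le> q' x" by (intro ge) (smt (verit))
    then show "q' (x + z) \<le> q' x + q' z" by simp
  next
    have "0 \<le> q' 0" by (rule ge) (use sublinear_scale[OF q] in simp)
    then show "q' 0 = 0" using le0[of 0] sublinear_zero[OF q] by simp
  next
    fix r :: real and x assume r: "r > 0"
    have "q' (r *\<^sub>R x) / r \<le> q' x"
    proof (rule ge)
      fix t :: real assume t: "t \<ge> 0"
      have "q' (r *\<^sub>R x) \<le> q (r *\<^sub>R (x + t *\<^sub>R y)) - (r * t) * q y"
        using le[of "r * t" "r *\<^sub>R x"] r t by (simp add: algebra_simps)
      also have "\<dots> = r * (q (x + t *\<^sub>R y) - t * q y)"
        using r sublinear_scale[OF q, of r "x + t *\<^sub>R y"] by (simp add: right_diff_distrib)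
      finally show "q' (r *\<^sub>R x) / r \<le> q (x + t *\<^sub>R y) - t * q y"
        using r by (simp add: field_simps)
    qed
    then show "q' (r *\<^sub>R x) \<le> r * q' x" using r by (simp add: field_simps)
  qed
  moreover have "q' (- y) \<le> - q y" using le[of 1 "- y"] sublinear_zero[OF q] by simp
  ultimately show ?thesis using that le0 ge by blast
qed

text \<open>A minimal sublinear functional is fixed by every contraction, hence odd, hence linear.\<close>

lemma linear_below_sublinear:
  assumes p: "sublinear (p :: 'v::real_vector \<Rightarrow> real)"
  obtains \<phi> where "linear \<phi>" "\<And>x. \<phi> x \<le> p x"
proof -
  define S where "S = {q. sublinear q \<and> q \<le> p}"
  \<comment> \<open>The order is reversed, so that the maximal element supplied by Zorn's lemma is a
    minimal sublinear functional.\<close>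
  define P where "P q r \<longleftrightarrow> r \<le> q" for q r :: "'v \<Rightarrow> real"
  have "\<exists>m\<in>S. \<forall>a\<in>S. P m a \<longrightarrow> a = m"
  proof (rule predicate_Zorn)
    show "partial_order_on S (relation_of P S)"
      unfolding partial_order_on_def preorder_on_def refl_on_def trans_def antisym_def
        relation_of_def P_def by auto
  next
    fix C assume "C \<in> Chains (relation_of P S)"
    then have CS: "C \<subseteq> S" and tot: "\<And>q r. q \<in> C \<Longrightarrow> r \<in> C \<Longrightarrow> q \<le> r \<or> r \<le> q"
      unfolding Chains_def relation_of_def P_def by auto
    show "\<exists>u\<in>S. \<forall>a\<in>C. P a u"
    proof (cases "C = {}")
      case True
      then show ?thesis using p by (auto simp: S_def)
    next
      case False
      define u where "u x = (INF q\<in>C. q x)" for x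
      have sub: "sublinear q" "q x \<le> p x" if "q \<in> C" for q x
        using that CS by (auto simp: S_def le_fun_def)
      have bdd: "bdd_below ((\<lambda>q. q x) ` C)" for x
      proof (rule bdd_belowI2)
        fix q assume "q \<in> C"
        then show "- p (- x) \<le> q x"
          using sublinear_ge_uminus[of q x] sub(1)[of q] sub(2)[of q "- x"] by linarith
      qed
      have le: "u x \<le> q x" if "q \<in> C" for q x
        unfolding u_def using that by (intro cINF_lower bdd)
      have ge: "c \<le> u x" if "\<And>q. q \<in> C \<Longrightarrow> c \<le> q x" for c x
        unfolding u_def using that False by (intro cINF_greatest) auto
      have "sublinear u"
      proof (rule sublinearI)
        fix x z
        \<comment> \<open>The infima at \<open>x\<close> and \<open>z\<close> are approached by
          different members of the chain; the smaller of the two serves at both points.\<close>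
        have 1: "u (x + z) \<le> q x + r z" if "q \<in> C" "r \<in> C" for q r
        proof -
          obtain m where m: "m \<in> C" "m \<le> q" "m \<le> r" using tot \<open>q \<in> C\<close> \<open>r \<in> C\<close> by blast
          have "u (x + z) \<le> m x + m z"
            using le[OF m(1), of "x + z"] sublinear_add[OF sub(1)[OF m(1)], of x z] by simp
          then show ?thesis using m(2,3) by (smt (verit) le_funD)
        qed
        have "u (x + z) - q x \<le> u z" if "q \<in> C" for q
          by (rule ge) (use 1 that in \<open>smt (verit)\<close>)
        then have "u (x + z) - u z \<le> u x" by (intro ge) (smt (verit))
        then show "u (x + z) \<le> u x + u z" by simp
      next
        obtain q where "q \<in> C" using False by blast
        then have "u 0 \<le> 0" using le[of q 0] sublinear_zero[OF sub(1)[of q]] by simp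
        moreover have "0 \<le> u 0"
        proof (rule ge)
          fix q assume "q \<in> C"
          from sublinear_zero[OF sub(1)[OF this]] show "0 \<le> q 0" by simp
        qed
        ultimately show "u 0 = 0" by simp
      next
        fix r :: real and x assume r: "r > 0"
        have "u (r *\<^sub>R x) / r \<le> u x"
        proof (rule ge)
          fix q assume "q \<in> C"
          then show "u (r *\<^sub>R x) / r \<le> q x"
            using le[of q "r *\<^sub>R x"] sublinear_scale[OF sub(1), of q r x] r by (simp add: field_simps)
        qed
        then show "u (r *\<^sub>R x) \<le> r * u x" using r by (simp add: field_simps)
      qed
      moreover have "u \<le> p"
      proof (rule le_funI)
        fix x
        obtain q where "q \<in> C" using False by blast
        then show "u x \<le> p x" using le[of q x] sub(2)[of q x] by simp
      qed
      ultimately have "u \<in> S" by (simp add: S_def)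
      then show ?thesis using le by (auto simp: P_def le_fun_def)
    qed
  qed
  then obtain m where m: "sublinear m" "m \<le> p"
    and min: "\<And>a. sublinear a \<Longrightarrow> a \<le> m \<Longrightarrow> a = m"
    unfolding S_def P_def by (auto intro: order_trans)
  have neg: "m (- y) = - m y" for y
  proof -
    obtain q' where "sublinear q'" "\<And>x. q' x \<le> m x" "q' (- y) \<le> - m y"
      using sublinear_contract[OF m(1), of y] by metis
    then have "m (- y) \<le> - m y" using min[of q'] by (auto simp: le_fun_def)
    then show ?thesis using sublinear_ge_uminus[OF m(1), of y] by simp
  qed
  have "linear m"
  proof (rule linearI)
    fix x y
    have "m (- x + - y) \<le> m (- x) + m (- y)" by (rule sublinear_add[OF m(1)])
    then have "m x + m y \<le> m (x + y)" using neg[of "x + y"] neg[of x] neg[of y] by simp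
    then show "m (x + y) = m x + m y" using sublinear_add[OF m(1), of x y] by simp
  next
    fix r x
    show "m (r *\<^sub>R x) = r *\<^sub>R m x"
    proof (cases "r \<ge> 0")
      case True
      then show ?thesis using sublinear_scale[OF m(1)] by simp
    next
      case False
      then have "m (- ((- r) *\<^sub>R x)) = - ((- r) * m x)"
        using neg sublinear_scale[OF m(1), of "- r"] by simp
      then show ?thesis by simp
    qed
  qed
  then show ?thesis using that m(2) by (auto simp: le_fun_def)
qed

text \<open>The assumption is what any such functional forces for c = \<phi>(f), since \<phi>(f) + t
  = \<phi>(f + t 1) \<le> norm (f + t 1). Conversely, contracting the norm at 1 fixes the value 1
  there and leaves a value at least \<open>c\<close> at \<open>f\<close>; a second contraction at
  \<open>f\<close> makes \<phi> attain that value.\<close>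

lemma unital_contractive_functional:
  fixes f :: "'v::real_normed_algebra_1"
  assumes "\<And>t. t \<ge> 0 \<Longrightarrow> c \<le> norm (f + t *\<^sub>R 1) - t"
  obtains \<phi> where "linear \<phi>" "\<And>x. \<phi> x \<le> norm x" "\<phi> 1 = 1" "c \<le> \<phi> f"
proof -
  have "sublinear (norm :: 'v \<Rightarrow> real)"
    by (rule sublinearI) (auto simp: norm_triangle_ineq)
  then obtain p where p: "sublinear p" "\<And>x. p x \<le> norm (x::'v)" "p (- 1) \<le> - 1"
    "\<And>x c. (\<And>t. t \<ge> 0 \<Longrightarrow> c \<le> norm (x + t *\<^sub>R 1) - t) \<Longrightarrow> c \<le> p x"
    using sublinear_contract[of "norm :: 'v \<Rightarrow> real" 1] by (metis mult.right_neutral norm_one)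
  obtain q where q: "sublinear q" "\<And>x. q x \<le> p x" "q (- f) \<le> - p f"
    using sublinear_contract[OF p(1), of f] by metis
  obtain \<phi> where \<phi>: "linear \<phi>" "\<And>x. \<phi> x \<le> q x"
    using linear_below_sublinear[OF q(1)] by metis
  have le: "\<phi> x \<le> norm x" for x using \<phi>(2) q(2) p(2) by (meson order_trans)
  have "- \<phi> 1 \<le> - 1"
    using \<phi>(2)[of "- 1"] q(2)[of "- 1"] p(3) linear_neg[OF \<phi>(1), of 1] by simp
  then have "\<phi> 1 = 1" using le[of 1] by simp
  moreover have "c \<le> p f" using assms by (rule p(4))
  then have "c \<le> \<phi> f" using \<phi>(2)[of "- f"] q(3) linear_neg[OF \<phi>(1), of f] by simp
  ultimately show ?thesis using that \<phi>(1) le by blast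
qed

subsection \<open>Square roots in C*-algebras\<close>

lemma scaleC_zero [simp]: "c *\<^sub>C (0::'a::unital_cstar_algebra) = 0"
  using scaleC_add_right[of c 0 "0::'a"] by simp

lemma scaleC_one [simp]: "1 *\<^sub>C x = x"
  using scaleR_scaleC[of 1 x] by simp

lemma scaleC_minus_right: "c *\<^sub>C (- x) = - (c *\<^sub>C x)"
  using scaleC_add_right[of c x "- x"] by (simp add: eq_neg_iff_add_eq_0 add.commute)

lemma star_scaleR: "star (r *\<^sub>R x) = r *\<^sub>R star x"
  by (simp add: scaleR_scaleC star_scaleC)

lemma star_zero [simp]: "star 0 = 0"
  using star_add[of 0 0] by simp

lemma star_minus: "star (- x) = - star x"
  using star_scaleR[of "-1" x] by simp

lemma star_diff: "star (x - y) = star x - star y"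
  using star_add[of x "- y"] by (simp add: star_minus)

lemma star_one [simp]: "star 1 = 1"
  using star_mult[of "star 1" 1] by (simp add: star_star)

lemma star_power: "star (x ^ n) = star x ^ n"
  by (induction n) (simp_all add: star_mult power_commutes)

lemma norm_star [simp]: "norm (star x) = norm x"
proof -
  have "norm y \<le> norm (star y)" for y :: 'a
  proof (cases "y = 0")
    case False
    have "norm y * norm y \<le> norm (star y) * norm y"
      using norm_mult_ineq[of "star y" y] by (simp add: cstar_identity power2_eq_square)
    then show ?thesis using False by simp
  qed simp
  from this[of x] this[of "star x"] show ?thesis by (simp add: star_star)
qed

lemma bounded_linear_star: "bounded_linear (star :: 'a::unital_cstar_algebra \<Rightarrow> 'a)"
  by (rule bounded_linear_intro[of _ 1]) (simp_all add: star_add star_scaleR)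

lemma star_mult_self_eq_0: "star x * x = 0 \<longleftrightarrow> x = 0"
  using cstar_identity[of x] by (metis mult_zero_right norm_eq_zero zero_eq_power2)

lemma self_adjoint_add: "self_adjoint x \<Longrightarrow> self_adjoint y \<Longrightarrow> self_adjoint (x + y)"
  and self_adjoint_diff: "self_adjoint x \<Longrightarrow> self_adjoint y \<Longrightarrow> self_adjoint (x - y)"
  and self_adjoint_minus: "self_adjoint x \<Longrightarrow> self_adjoint (- x)"
  and self_adjoint_scaleR: "self_adjoint x \<Longrightarrow> self_adjoint (r *\<^sub>R x)"
  and self_adjoint_one: "self_adjoint 1"
  and self_adjoint_star_mult: "self_adjoint (star y * y)"
  by (simp_all add: self_adjoint_def star_add star_diff star_minus star_scaleR star_mult star_star)

lemma self_adjoint_mult_self: "self_adjoint x \<Longrightarrow> self_adjoint (x * x)"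
  using self_adjoint_star_mult[of x] by (simp add: self_adjoint_def)

lemma self_adjoint_square_eq_0: "self_adjoint x \<Longrightarrow> x * x = 0 \<Longrightarrow> x = 0"
  using star_mult_self_eq_0[of x] by (simp add: self_adjoint_def)

lemma norm_self_adjoint_square: "self_adjoint x \<Longrightarrow> norm (x * x) = (norm x)\<^sup>2"
  using cstar_identity[of x] by (simp add: self_adjoint_def)

definition Re_part :: "'a::unital_cstar_algebra \<Rightarrow> 'a" where
  "Re_part x = (1/2) *\<^sub>R (x + star x)"

definition Im_part :: "'a::unital_cstar_algebra \<Rightarrow> 'a" where
  "Im_part x = (- \<i> / 2) *\<^sub>C (x - star x)"

lemma self_adjoint_Re_part: "self_adjoint (Re_part x)"
  by (simp add: self_adjoint_def Re_part_def star_add star_scaleR star_star add.commute)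

lemma scaleC_diff_right: "c *\<^sub>C (x - y) = c *\<^sub>C x - c *\<^sub>C y"
  using scaleC_add_right[of c x "- y"] by (simp add: scaleC_minus_right)

lemma scaleC_minus_left: "(- c) *\<^sub>C x = - (c *\<^sub>C x)"
  using scaleC_add_left[of c "- c" x] scaleR_scaleC[of 0 x] by (simp add: eq_neg_iff_add_eq_0 add.commute)

lemma self_adjoint_Im_part: "self_adjoint (Im_part x)"
proof -
  have "star (Im_part x) = (\<i> / 2) *\<^sub>C (star x - x)"
    by (simp add: Im_part_def star_scaleC star_diff star_star)
  also have "\<dots> = Im_part x"
    by (simp add: Im_part_def scaleC_diff_right scaleC_minus_left)
  finally show ?thesis by (simp add: self_adjoint_def)
qed

lemma Re_Im_part: "Re_part x + \<i> *\<^sub>C Im_part x = x"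
proof -
  have "\<i> *\<^sub>C Im_part x = (1/2) *\<^sub>R (x - star x)"
    by (simp add: Im_part_def scaleC_scaleC scaleR_scaleC)
  then have "Re_part x + \<i> *\<^sub>C Im_part x = (1/2) *\<^sub>R (x + x)"
    by (simp add: Re_part_def algebra_simps)
  then show ?thesis by (simp add: scaleR_2[symmetric])
qed

section \<open>The binomial series of sqrt(1 - y)\<close>

definition sqrt_coeff :: "nat \<Rightarrow> real" where
  "sqrt_coeff n = ((1/2) gchoose n) * (- 1) ^ n"

lemma sqrt_coeff_0 [simp]: "sqrt_coeff 0 = 1"
  by (simp add: sqrt_coeff_def)

lemma gbinomial_times_minus_one_power: "((a::real) gchoose n) * (- 1) ^ n = pochhammer (- a) n / fact n"
proof -
  have "(- 1 :: real) ^ n * (- 1) ^ n = 1" by (simp flip: power_mult_distrib)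
  then have "(- 1) ^ n * pochhammer (- a) n * (- 1) ^ n = pochhammer (- a) n"
    by (metis mult.assoc mult.commute mult_1)
  then show ?thesis by (simp add: gbinomial_pochhammer)
qed

text \<open>Summing coefficients amounts to dividing the series by 1 - y, so these are the
  coefficients of (1 - y)^(-1/2), which are visibly nonnegative.\<close>

lemma sqrt_coeff_sum: "(\<Sum>k\<le>n. sqrt_coeff k) = pochhammer (1/2) n / fact n"
  using gbinomial_sum_lower_neg[of "1/2::real" n] gbinomial_times_minus_one_power[of "-1/2" n]
  by (simp add: sqrt_coeff_def mult.commute)

lemma sqrt_coeff_sum_nonneg: "0 \<le> (\<Sum>k\<le>n. sqrt_coeff k)"
  by (simp add: sqrt_coeff_sum pochhammer_nonneg)

lemma sqrt_coeff_Suc_nonpos: "sqrt_coeff (Suc n) \<le> 0"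
proof -
  have "pochhammer (-1/2 :: real) (Suc n) = (-1/2) * pochhammer (1/2) n"
    by (simp add: pochhammer_rec)
  moreover have "pochhammer (1/2 :: real) n \<ge> 0" by (simp add: pochhammer_nonneg)
  ultimately have "pochhammer (-1/2 :: real) (Suc n) \<le> 0" by simp
  then show ?thesis
    using gbinomial_times_minus_one_power[of "1/2" "Suc n"]
    by (simp only: sqrt_coeff_def minus_divide_left divide_nonpos_pos fact_gt_zero)
qed

text \<open>All coefficients after the first are nonpositive, so the sum is 1 minus a nonnegative
  partial sum. The bound 1 serves twice: for absolute convergence on the closed unit ball, and for
  the distance of the root from 1.\<close>

lemma sum_abs_sqrt_coeff_Suc: "(\<Sum>k<n. \<bar>sqrt_coeff (Suc k)\<bar>) \<le> 1"
proof -
  have "(\<Sum>k<n. \<bar>sqrt_coeff (Suc k)\<bar>) = - (\<Sum>k<n. sqrt_coeff (Suc k))"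
    using sqrt_coeff_Suc_nonpos by (simp add: abs_of_nonpos sum_negf)
  also have "\<dots> = 1 - (\<Sum>k\<le>n. sqrt_coeff k)"
    by (simp add: sum.atMost_shift)
  finally show ?thesis using sqrt_coeff_sum_nonneg[of n] by simp
qed

lemma summable_abs_sqrt_coeff_Suc: "summable (\<lambda>n. \<bar>sqrt_coeff (Suc n)\<bar>)"
  by (rule summableI_nonneg_bounded[of _ 1]) (auto simp: sum_abs_sqrt_coeff_Suc)

text \<open>Vandermonde's identity with 1/2 + 1/2 = 1 leaves the coefficients of 1 - y.\<close>

lemma sqrt_coeff_convolution:
  "(\<Sum>i\<le>n. sqrt_coeff i * sqrt_coeff (n - i)) = (if n = 0 then 1 else if n = 1 then -1 else 0)"
proof -
  have "(\<Sum>i\<le>n. sqrt_coeff i * sqrt_coeff (n - i))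
      = (\<Sum>i\<le>n. (- 1) ^ n * (((1/2) gchoose i) * ((1/2) gchoose (n - i))))"
    by (rule sum.cong) (auto simp: sqrt_coeff_def power_add[symmetric])
  also have "\<dots> = (- 1) ^ n * ((1/2 + 1/2) gchoose n)"
    using gbinomial_Vandermonde[of "1/2::real" "1/2" n]
    by (simp add: sum_distrib_left[symmetric] atLeast0AtMost)
  also have "\<dots> = (- 1) ^ n * real (1 choose n)"
    using binomial_gbinomial[of 1 n, where 'a=real] by simp
  finally show ?thesis by (auto simp: binomial_eq_0)
qed

text \<open>The binomial series of \<open>\<surd>(1 - y)\<close>, which still converges absolutely for \<open>norm y = 1\<close>.\<close>

definition sqrt_series :: "'a::unital_cstar_algebra \<Rightarrow> 'a" where
  "sqrt_series y = (\<Sum>n. sqrt_coeff n *\<^sub>R y ^ n)"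

context
  fixes y :: "'a::unital_cstar_algebra"
  assumes y: "norm y \<le> 1"
begin

lemma norm_sqrt_term: "norm (sqrt_coeff n *\<^sub>R y ^ n) \<le> \<bar>sqrt_coeff n\<bar>"
proof -
  have "norm (y ^ n) \<le> 1"
    using norm_power_ineq[of y n] power_le_one[OF norm_ge_zero y, of n] by linarith
  then show ?thesis by (simp add: mult_left_le)
qed

lemma summable_norm_sqrt_term: "summable (\<lambda>n. norm (sqrt_coeff n *\<^sub>R y ^ n))"
proof (rule summable_comparison_test'[of "\<lambda>n. \<bar>sqrt_coeff n\<bar>" 0])
  show "summable (\<lambda>n. \<bar>sqrt_coeff n\<bar>)"
    using summable_abs_sqrt_coeff_Suc by (subst summable_Suc_iff[symmetric])
  show "norm (norm (sqrt_coeff n *\<^sub>R y ^ n)) \<le> \<bar>sqrt_coeff n\<bar>" for n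
    using norm_sqrt_term[of n] by simp
qed

lemma summable_sqrt_term: "summable (\<lambda>n. sqrt_coeff n *\<^sub>R y ^ n)"
  using summable_norm_sqrt_term by (rule summable_norm_cancel)

lemma sqrt_series_square: "sqrt_series y * sqrt_series y = 1 - y"
proof -
  have eq: "(\<Sum>i\<le>n. (sqrt_coeff i *\<^sub>R y ^ i) * (sqrt_coeff (n - i) *\<^sub>R y ^ (n - i)))
      = (if n = 0 then 1 else if n = 1 then - y else 0)" for n
  proof -
    have "(\<Sum>i\<le>n. (sqrt_coeff i *\<^sub>R y ^ i) * (sqrt_coeff (n - i) *\<^sub>R y ^ (n - i)))
        = (\<Sum>i\<le>n. (sqrt_coeff i * sqrt_coeff (n - i)) *\<^sub>R y ^ n)"
      by (rule sum.cong) (auto simp: power_add[symmetric] mult.commute)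
    also have "\<dots> = (\<Sum>i\<le>n. sqrt_coeff i * sqrt_coeff (n - i)) *\<^sub>R y ^ n"
      by (rule scaleR_left.sum[symmetric])
    finally show ?thesis by (simp add: sqrt_coeff_convolution)
  qed
  have "sqrt_series y * sqrt_series y
      = (\<Sum>n. \<Sum>i\<le>n. (sqrt_coeff i *\<^sub>R y ^ i) * (sqrt_coeff (n - i) *\<^sub>R y ^ (n - i)))"
    unfolding sqrt_series_def by (intro Cauchy_product summable_norm_sqrt_term)
  also have "\<dots> = (\<Sum>n. if n = 0 then 1 else if n = 1 then - y else 0)"
    by (simp only: eq)
  also have "\<dots> = (\<Sum>n\<in>{0, 1::nat}. if n = 0 then 1 else if n = 1 then - y else 0)"
    by (rule suminf_finite) auto
  finally show ?thesis by simp
qed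

text \<open>This keeps the root in the unit ball around 1, so that after rescaling the root of a
  positive element is positive again.\<close>

lemma norm_one_minus_sqrt_series: "norm (1 - sqrt_series y) \<le> 1"
proof -
  have "sqrt_series y = (\<Sum>n. sqrt_coeff (Suc n) *\<^sub>R y ^ Suc n) + 1"
    unfolding sqrt_series_def using suminf_split_head[OF summable_sqrt_term] by simp
  then have "norm (1 - sqrt_series y) = norm (\<Sum>n. sqrt_coeff (Suc n) *\<^sub>R y ^ Suc n)"
    by simp
  also have "\<dots> \<le> (\<Sum>n. \<bar>sqrt_coeff (Suc n)\<bar>)"
    by (rule norm_suminf_le[OF norm_sqrt_term summable_abs_sqrt_coeff_Suc])
  also have "\<dots> \<le> 1"
    by (rule suminf_le_const[OF summable_abs_sqrt_coeff_Suc sum_abs_sqrt_coeff_Suc])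
  finally show ?thesis .
qed

lemma star_sqrt_series: "star (sqrt_series y) = sqrt_series (star y)"
  unfolding sqrt_series_def
  by (simp add: bounded_linear.suminf[OF bounded_linear_star summable_sqrt_term] star_scaleR star_power)

lemma sqrt_series_in_subalgebra:
  assumes B: "unital_cstar_subalgebra B" and "y \<in> B"
  shows "sqrt_series y \<in> B"
proof -
  have add: "u + v \<in> B" and scale: "r *\<^sub>R u \<in> B" and mult: "u * v \<in> B"
    if "u \<in> B" "v \<in> B" for u v r
    using that B by (auto simp: unital_cstar_subalgebra_def scaleR_scaleC)
  have one: "1 \<in> B" using B by (simp add: unital_cstar_subalgebra_def)
  have zero: "0 \<in> B" using scale[OF one one, of 0] by simp
  have pow: "y ^ n \<in> B" for n by (induction n) (auto simp: one mult \<open>y \<in> B\<close>)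
  have partial: "(\<Sum>k<n. sqrt_coeff k *\<^sub>R y ^ k) \<in> B" for n
    by (induction n) (auto simp: zero add scale pow)
  have "(\<lambda>n. \<Sum>k<n. sqrt_coeff k *\<^sub>R y ^ k) \<longlonglongrightarrow> sqrt_series y"
    unfolding sqrt_series_def using summable_LIMSEQ[OF summable_sqrt_term] .
  moreover have "closed B" using B by (simp add: unital_cstar_subalgebra_def)
  ultimately show ?thesis by (metis closed_sequentially partial)
qed

end

lemma intertwine_power:
  fixes x :: "'a::monoid_mult"
  assumes "x * t = t * y"
  shows "x ^ n * t = t * y ^ n"
proof (induction n)
  case (Suc n)
  have "x ^ Suc n * t = x * (t * y ^ n)" using Suc by (simp add: mult.assoc)
  also have "\<dots> = t * y ^ Suc n" by (simp add: assms mult.assoc[symmetric])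
  finally show ?case .
qed simp

text \<open>The relation passes to powers and then to the limit. With \<open>x = y\<close> it gives
  commutation of roots; with \<open>x\<close> and \<open>y\<close> different it carries information
  from \<open>star t * t\<close> to \<open>t * star t\<close>.\<close>

lemma sqrt_series_intertwine:
  assumes "norm x \<le> 1" "norm y \<le> 1" "x * t = t * y"
  shows "sqrt_series x * t = t * sqrt_series y"
  unfolding sqrt_series_def
  by (simp add: suminf_mult2[OF summable_sqrt_term[OF assms(1)]]
      suminf_mult[OF summable_sqrt_term[OF assms(2)], symmetric] intertwine_power[OF assms(3)])

text \<open>Dividing by \<open>s\<close> moves the ball of radius \<open>s\<close> around
  \<open>s\<close> to the unit ball around 1. The scale is an explicit parameter so that two
  elements can be given roots by the same series, as intertwining requires.\<close>

definition sa_sqrt :: "real \<Rightarrow> 'a::unital_cstar_algebra \<Rightarrow> 'a" where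
  "sa_sqrt s h = sqrt s *\<^sub>R sqrt_series (1 - (1 / s) *\<^sub>R h)"

context
  fixes s :: real and h :: "'a::unital_cstar_algebra"
  assumes s: "s > 0" and h: "norm (s *\<^sub>R 1 - h) \<le> s"
begin

lemma norm_sqrt_argument: "norm (1 - (1 / s) *\<^sub>R h) \<le> 1"
proof -
  have "1 - (1 / s) *\<^sub>R h = (1 / s) *\<^sub>R (s *\<^sub>R 1 - h)"
    using s by (simp add: algebra_simps)
  then have "norm (1 - (1 / s) *\<^sub>R h) = (1 / s) * norm (s *\<^sub>R 1 - h)" using s by (simp only: norm_scaleR) simp
  then show ?thesis using s h by simp
qed

lemma sa_sqrt_square: "sa_sqrt s h * sa_sqrt s h = h"
  using s by (simp add: sa_sqrt_def sqrt_series_square[OF norm_sqrt_argument])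

lemma norm_sa_sqrt: "norm (sqrt s *\<^sub>R 1 - sa_sqrt s h) \<le> sqrt s"
proof -
  have "sqrt s *\<^sub>R 1 - sa_sqrt s h = sqrt s *\<^sub>R (1 - sqrt_series (1 - (1 / s) *\<^sub>R h))"
    by (simp add: sa_sqrt_def algebra_simps)
  then show ?thesis
    using s norm_one_minus_sqrt_series[OF norm_sqrt_argument] by (simp add: mult_left_le)
qed

lemma self_adjoint_sa_sqrt: "self_adjoint h \<Longrightarrow> self_adjoint (sa_sqrt s h)"
  using star_sqrt_series[OF norm_sqrt_argument]
  by (simp add: sa_sqrt_def self_adjoint_def star_scaleR star_diff)

lemma sa_sqrt_in_subalgebra:
  assumes B: "unital_cstar_subalgebra B" and "h \<in> B"
  shows "sa_sqrt s h \<in> B"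
proof -
  have scale: "r *\<^sub>R u \<in> B" if "u \<in> B" for r u
    using that B by (auto simp: unital_cstar_subalgebra_def scaleR_scaleC)
  have "1 \<in> B" and add: "\<And>u v. u \<in> B \<Longrightarrow> v \<in> B \<Longrightarrow> u + v \<in> B"
    using B by (auto simp: unital_cstar_subalgebra_def)
  then have "1 + (- 1 / s) *\<^sub>R h \<in> B" using scale \<open>h \<in> B\<close> by blast
  then show ?thesis
    using scale sqrt_series_in_subalgebra[OF norm_sqrt_argument B] by (simp add: sa_sqrt_def)
qed

end

lemma sa_sqrt_intertwine:
  assumes "s > 0" "norm (s *\<^sub>R 1 - x) \<le> s" "norm (s *\<^sub>R 1 - y) \<le> s" "x * t = t * y"
  shows "sa_sqrt s x * t = t * sa_sqrt s y"
proof -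
  have "(1 - (1 / s) *\<^sub>R x) * t = t * (1 - (1 / s) *\<^sub>R y)"
    using assms(4) by (simp add: algebra_simps)
  then show ?thesis
    using sqrt_series_intertwine[OF norm_sqrt_argument[OF assms(1,2)] norm_sqrt_argument[OF assms(1,3)]]
    by (simp add: sa_sqrt_def)
qed

subsection \<open>Positive elements\<close>

text \<open>The commutator term vanishes when \<open>g\<close> and \<open>k\<close> commute, and it
  changes sign with \<open>k\<close>, so it cancels in
  \<open>star t * t + t * star t\<close>.\<close>

lemma star_mult_cartesian:
  assumes g: "self_adjoint g" and k: "self_adjoint k"
  shows "star (g + \<i> *\<^sub>C k) * (g + \<i> *\<^sub>C k) = g * g + k * k + \<i> *\<^sub>C (g * k - k * g)"
proof -
  have "star (g + \<i> *\<^sub>C k) = g - \<i> *\<^sub>C k"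
    using g k by (simp add: self_adjoint_def star_add star_scaleC scaleC_minus_left)
  moreover have "(g - \<i> *\<^sub>C k) * (g + \<i> *\<^sub>C k)
      = g * g + \<i> *\<^sub>C (g * k) - \<i> *\<^sub>C (k * g) - (\<i> * \<i>) *\<^sub>C (k * k)"
    by (simp add: algebra_simps mult_scaleC_left mult_scaleC_right scaleC_diff_right scaleC_scaleC scaleC_minus_left)
  ultimately show ?thesis
    by (simp add: scaleC_diff_right scaleC_minus_left)
qed

text \<open>With \<open>g = \<surd>(1 - k\<^sup>2)\<close>, the element \<open>g + \<i> k\<close> is unitary and \<open>g\<close> is its real part.\<close>

lemma norm_one_minus_square:
  assumes k: "self_adjoint k" and n: "norm k \<le> 1"
  shows "norm (1 - k * k) \<le> 1"
proof -
  have le: "norm (k * k) \<le> 1"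
    using n by (simp add: norm_self_adjoint_square[OF k] power_le_one)
  define g where "g = sqrt_series (k * k)"
  have gsa: "self_adjoint g"
    using star_sqrt_series[OF le] self_adjoint_mult_self[OF k] by (simp add: g_def self_adjoint_def)
  have gg: "g * g = 1 - k * k" unfolding g_def by (rule sqrt_series_square[OF le])
  have gk: "g * k = k * g"
    unfolding g_def by (rule sqrt_series_intertwine[OF le le]) (simp add: mult.assoc)
  define u where "u = g + \<i> *\<^sub>C k"
  have "star u * u = 1"
    using star_mult_cartesian[OF gsa k] by (simp add: u_def gg gk)
  then have "norm u = 1"
    using cstar_identity[of u] by (simp add: power2_eq_1_iff) (smt (verit) norm_ge_zero)
  moreover have "star u = g - \<i> *\<^sub>C k"
    using gsa k by (simp add: u_def self_adjoint_def star_add star_scaleC scaleC_minus_left)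
  then have "2 *\<^sub>R g = u + star u" by (simp add: u_def scaleR_2)
  then have "2 * norm g \<le> norm u + norm (star u)"
    using norm_triangle_ineq[of u "star u"] by (metis norm_scaleR abs_numeral)
  ultimately have "norm g \<le> 1" by simp
  then show ?thesis
    using norm_self_adjoint_square[OF gsa] by (simp add: gg power_le_one)
qed

text \<open>
  A norm criterion for \<open>spectrum h \<subseteq> [0, \<infinity>)\<close>: some ball of radius \<open>s\<close> around \<open>s\<close> contains \<open>h\<close>.
\<close>

definition pos_element :: "'a::unital_cstar_algebra \<Rightarrow> bool" where
  "pos_element h \<longleftrightarrow> self_adjoint h \<and> (\<exists>s. norm (s *\<^sub>R 1 - h) \<le> s)"

lemma pos_element_self_adjoint: "pos_element h \<Longrightarrow> self_adjoint h"
  by (simp add: pos_element_def)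

lemma norm_scale_one_diff_mono:
  fixes h :: "'a::real_normed_algebra_1"
  assumes "norm (s *\<^sub>R 1 - h) \<le> s" "s \<le> r"
  shows "norm (r *\<^sub>R 1 - h) \<le> r"
proof -
  have "r *\<^sub>R 1 - h = (r - s) *\<^sub>R 1 + (s *\<^sub>R 1 - h)" by (simp add: algebra_simps)
  then have "norm (r *\<^sub>R 1 - h) \<le> norm ((r - s) *\<^sub>R (1::'a)) + norm (s *\<^sub>R 1 - h)"
    by (simp only: norm_triangle_ineq)
  then show ?thesis using assms by simp
qed

lemma pos_element_add:
  assumes "pos_element x" "pos_element y"
  shows "pos_element (x + y)"
proof -
  obtain s r where "norm (s *\<^sub>R 1 - x) \<le> s" "norm (r *\<^sub>R 1 - y) \<le> r"
    using assms by (auto simp: pos_element_def)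
  moreover have "(s + r) *\<^sub>R 1 - (x + y) = (s *\<^sub>R 1 - x) + (r *\<^sub>R 1 - y)"
    by (simp add: algebra_simps)
  ultimately have "norm ((s + r) *\<^sub>R 1 - (x + y)) \<le> s + r"
    using norm_triangle_ineq[of "s *\<^sub>R 1 - x" "r *\<^sub>R 1 - y"] by (metis add_mono order_trans)
  then show ?thesis using assms by (auto simp: pos_element_def self_adjoint_add)
qed

lemma norm_scale_one_minus_square:
  fixes k :: "'a::unital_cstar_algebra"
  assumes k: "self_adjoint k" and s: "s > 0" "(norm k)\<^sup>2 \<le> s"
  shows "norm (s *\<^sub>R 1 - k * k) \<le> s"
proof -
  define j where "j = (1 / sqrt s) *\<^sub>R k"
  have "norm k \<le> sqrt s" using s(2) by (simp add: real_le_rsqrt)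
  then have "norm (1 - j * j) \<le> 1"
    using s(1) k by (intro norm_one_minus_square) (simp_all add: j_def self_adjoint_scaleR)
  moreover have "s *\<^sub>R 1 - k * k = s *\<^sub>R (1 - j * j)"
    using s(1) by (simp add: j_def algebra_simps)
  ultimately show ?thesis using s(1) by (simp add: mult_left_le)
qed

lemma pos_element_square:
  assumes "self_adjoint k"
  shows "pos_element (k * k)"
  \<comment> \<open>The summand 1 keeps the radius positive when \<open>k = 0\<close>.\<close>
  unfolding pos_element_def using norm_scale_one_minus_square[OF assms, of "(norm k)\<^sup>2 + 1"]
  by (auto simp: self_adjoint_mult_self assms add_nonneg_pos)

lemma pos_element_sqrt:
  assumes "pos_element h"
  obtains g where "pos_element g" "g * g = h" "\<And>t. h * t = t * h \<Longrightarrow> g * t = t * g"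
proof -
  obtain s0 where s0: "norm (s0 *\<^sub>R 1 - h) \<le> s0" using assms by (auto simp: pos_element_def)
  \<comment> \<open>\<open>s0\<close> may be 0, whereas \<open>sa_sqrt\<close> divides by its
    scale.\<close>
  define s where "s = max s0 1"
  have s: "s > 0" "norm (s *\<^sub>R 1 - h) \<le> s"
    using norm_scale_one_diff_mono[OF s0, of s] by (auto simp: s_def)
  show ?thesis
  proof (rule that[of "sa_sqrt s h"])
    show "pos_element (sa_sqrt s h)"
      using self_adjoint_sa_sqrt[OF s] norm_sa_sqrt[OF s] assms by (auto simp: pos_element_def)
    show "sa_sqrt s h * sa_sqrt s h = h" by (rule sa_sqrt_square[OF s])
    show "sa_sqrt s h * t = t * sa_sqrt s h" if "h * t = t * h" for t
      using sa_sqrt_intertwine[OF s(1) s(2) s(2) that] .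
  qed
qed

text \<open>Let g^2 = h and k^2 = -h with commuting positive \<open>g\<close> and \<open>k\<close>.
  Then g + i k has vanishing star product with itself, so it is 0 by the C*-identity; adding its
  adjoint g - i k gives g = 0.\<close>

lemma pos_element_antisym:
  assumes "pos_element h" "pos_element (- h)"
  shows "h = 0"
proof -
  obtain g where g: "pos_element g" "g * g = h" using pos_element_sqrt[OF assms(1)] by metis
  obtain k where k: "pos_element k" "k * k = - h" "\<And>t. - h * t = t * - h \<Longrightarrow> k * t = t * k"
    using pos_element_sqrt[OF assms(2)] by metis
  have "h * g = g * h" by (metis g(2) mult.assoc)
  then have "k * g = g * k" by (intro k(3)) simp
  then have "star (g + \<i> *\<^sub>C k) * (g + \<i> *\<^sub>C k) = 0"
    using star_mult_cartesian[of g k] g(1,2) k(1,2) by (simp add: pos_element_self_adjoint)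
  then have z: "g + \<i> *\<^sub>C k = 0" by (simp add: star_mult_self_eq_0)
  then have "star (g + \<i> *\<^sub>C k) = 0" by simp
  then have "g - \<i> *\<^sub>C k = 0"
    using pos_element_self_adjoint[OF g(1)] pos_element_self_adjoint[OF k(1)]
    by (simp add: self_adjoint_def star_add star_scaleC scaleC_minus_left)
  with z have "g + g = 0" by (simp add: add_eq_0_iff)
  then have "2 *\<^sub>R g = 0" by (simp add: scaleR_2)
  then show ?thesis using g(2) by simp
qed

text \<open>For d = p - g both d p d and d g d are positive, and their sum is d (p^2 - g^2) = 0.
  Antisymmetry makes each of them 0, and their difference is d^3.\<close>

lemma pos_element_sqrt_unique:
  assumes p: "pos_element p" and g: "pos_element g" and sq: "g * g = p * p" and comm: "g * p = p * g"
  shows "g = p"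
proof -
  define d where "d = p - g"
  have dsa: "self_adjoint d" using p g by (simp add: d_def pos_element_self_adjoint self_adjoint_diff)
  have pos: "pos_element (d * (q * d))" if q: "pos_element q" "q * d = d * q" for q
  proof -
    obtain w where w: "pos_element w" "w * w = q" "\<And>t. q * t = t * q \<Longrightarrow> w * t = t * w"
      using pos_element_sqrt[OF q(1)] by metis
    have wd: "w * d = d * w" using w(3) q(2) by blast
    have "star (w * d) = w * d"
      using pos_element_self_adjoint[OF w(1)] dsa wd by (simp add: self_adjoint_def star_mult)
    then have "pos_element ((w * d) * (w * d))" by (intro pos_element_square) (simp add: self_adjoint_def)
    moreover have "(w * d) * (w * d) = d * (q * d)"
      by (metis mult.assoc w(2) wd)
    ultimately show ?thesis by simp
  qed
  have "p * d = d * p" "g * d = d * g" using comm by (simp_all add: d_def algebra_simps)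
  then have pd: "pos_element (d * (p * d))" "pos_element (d * (g * d))"
    using pos p g by simp_all
  have "(p + g) * d = 0" using sq comm by (simp add: d_def algebra_simps)
  then have "d * (p * d) + d * (g * d) = 0"
    by (metis distrib_left distrib_right mult_zero_right)
  then have neg: "d * (g * d) = - (d * (p * d))" by (simp add: eq_neg_iff_add_eq_0 add.commute)
  then have "d * (p * d) = 0" using pos_element_antisym[OF pd(1)] pd(2) by simp
  then have "d * (p * d) - d * (g * d) = 0" using neg by simp
  then have "d * (d * d) = 0" by (simp add: d_def algebra_simps)
  \<comment> \<open>The C*-identity only cancels squares, so the cube is raised to the fourth power
    and halved twice.\<close>
  then have "(d * d) * (d * d) = 0" by (simp add: mult.assoc)
  then have "d * d = 0" using self_adjoint_square_eq_0 self_adjoint_mult_self[OF dsa] by blast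
  then have "d = 0" using self_adjoint_square_eq_0 dsa by blast
  then show ?thesis by (simp add: d_def)
qed

text \<open>
  Replaces the usual argument via \<open>spectrum (t * star t) \<union> {0} = spectrum (star t * t) \<union> {0}\<close>:
  for \<open>p = - star t * t\<close> and \<open>q = - t * star t\<close> one has \<open>q * t = t * p\<close>, so the same power series
  gives \<open>\<bar>q\<bar> * t = t * \<bar>p\<bar> = t * p = q * t\<close>, whence \<open>(\<bar>q\<bar> - q) * q = 0\<close>.
\<close>

lemma pos_element_neg_mult_star:
  assumes p: "pos_element (- (star t * t))"
  shows "pos_element (- (t * star t))"
proof -
  define p where "p = - (star t * t)"
  define q where "q = - (t * star t)"
  have ppos: "pos_element p" and psa: "self_adjoint p"
    using p by (simp_all add: p_def pos_element_self_adjoint)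
  have qsa: "self_adjoint q"
    using self_adjoint_minus[OF self_adjoint_star_mult[of "star t"]] by (simp add: q_def star_star)
  \<comment> \<open>One scale for both squares, so that their roots come from the same power
    series.\<close>
  define s where "s = max ((norm p)\<^sup>2) ((norm q)\<^sup>2) + 1"
  have s: "s > 0" "(norm p)\<^sup>2 \<le> s" "(norm q)\<^sup>2 \<le> s"
    by (auto simp: s_def add_nonneg_pos le_max_iff_disj)
  note np = norm_scale_one_minus_square[OF psa s(1,2)]
  note nq = norm_scale_one_minus_square[OF qsa s(1,3)]
  have qt: "q * t = t * p" by (simp add: q_def p_def mult.assoc)
  then have "(q * q) * t = t * (p * p)" by (metis mult.assoc)
  then have "sa_sqrt s (q * q) * t = t * sa_sqrt s (p * p)"
    by (rule sa_sqrt_intertwine[OF s(1) nq np])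
  \<comment> \<open>Here the positivity of \<open>p\<close> enters: the absolute value of
    \<open>p\<close> is \<open>p\<close> itself.\<close>
  moreover have "sa_sqrt s (p * p) = p"
  proof (rule pos_element_sqrt_unique[OF ppos])
    show "pos_element (sa_sqrt s (p * p))"
      using self_adjoint_sa_sqrt[OF s(1) np] norm_sa_sqrt[OF s(1) np] self_adjoint_mult_self[OF psa]
      by (auto simp: pos_element_def)
    show "sa_sqrt s (p * p) * sa_sqrt s (p * p) = p * p" by (rule sa_sqrt_square[OF s(1) np])
    show "sa_sqrt s (p * p) * p = p * sa_sqrt s (p * p)"
      by (rule sa_sqrt_intertwine[OF s(1) np np]) (simp add: mult.assoc)
  qed
  moreover define m where "m = sa_sqrt s (q * q)"
  ultimately have mt: "m * t = q * t" by (simp add: qt)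
  have mpos: "pos_element m"
    using self_adjoint_sa_sqrt[OF s(1) nq] norm_sa_sqrt[OF s(1) nq] self_adjoint_mult_self[OF qsa]
    by (auto simp: pos_element_def m_def)
  have mm: "m * m = q * q" unfolding m_def by (rule sa_sqrt_square[OF s(1) nq])
  have mq_comm: "m * q = q * m"
    unfolding m_def by (rule sa_sqrt_intertwine[OF s(1) nq nq]) (simp add: mult.assoc)
  have "m * q = - ((m * t) * star t)" by (simp add: q_def mult.assoc)
  also have "\<dots> = q * q" unfolding mt by (simp add: q_def mult.assoc)
  finally have mq: "m * q = q * q" .
  \<comment> \<open>All four products in the expansion equal \<open>q * q\<close>, and they
    cancel.\<close>
  have "(m - q) * (m - q) = 0" by (simp add: algebra_simps mm mq mq_comm[symmetric])
  then have "m - q = 0"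
    using self_adjoint_square_eq_0 self_adjoint_diff[OF pos_element_self_adjoint[OF mpos] qsa] by blast
  then have "m = q" by simp
  then show ?thesis using mpos by (simp add: q_def)
qed

text \<open>
  Here \<open>v\<close> is twice the negative part of \<open>h = star a * a\<close>. For \<open>t = a * v\<close> the element
  \<open>- star t * t\<close> is a square, while \<open>star t * t + t * star t\<close> is a sum of squares; this forces \<open>t = 0\<close>.
\<close>

theorem pos_element_star_mult: "pos_element (star a * a)"
proof -
  define h where "h = star a * a"
  have hsa: "self_adjoint h" by (simp add: h_def self_adjoint_star_mult)
  \<comment> \<open>\<open>g\<close> plays the role of the absolute value of
    \<open>h\<close>.\<close>
  obtain g where g: "pos_element g" "g * g = h * h" "\<And>t. (h * h) * t = t * (h * h) \<Longrightarrow> g * t = t * g"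
    using pos_element_sqrt[OF pos_element_square[OF hsa]] by metis
  have gh: "g * h = h * g" by (rule g(3)) (simp add: mult.assoc)
  \<comment> \<open>The root of \<open>g\<close> turns v g v into the square of the self-adjoint
    element \<open>w * v\<close>.\<close>
  obtain w where w: "pos_element w" "w * w = g" "\<And>t. g * t = t * g \<Longrightarrow> w * t = t * w"
    using pos_element_sqrt[OF g(1)] by metis
  define v where "v = g - h"
  have vsa: "self_adjoint v"
    using pos_element_self_adjoint[OF g(1)] hsa by (simp add: v_def self_adjoint_diff)
  have wv: "w * v = v * w" by (rule w(3)) (simp add: v_def algebra_simps gh)
  have hv: "h * v = - (g * v)" by (simp add: v_def algebra_simps g(2) gh)
  define t where "t = a * v"
  have "star t * t = v * (h * v)"
    using vsa by (simp add: t_def h_def star_mult self_adjoint_def mult.assoc)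
  also have "\<dots> = - (v * (w * (w * v)))" by (simp add: hv w(2)[symmetric] mult.assoc)
  also have "\<dots> = - ((w * v) * (w * v))" by (metis wv mult.assoc)
  finally have tt: "star t * t = - ((w * v) * (w * v))" .
  have "self_adjoint (w * v)"
    using pos_element_self_adjoint[OF w(1)] vsa wv by (simp add: self_adjoint_def star_mult)
  then have neg: "pos_element (- (star t * t))" by (simp add: tt pos_element_square)
  have star_t: "star t * t + t * star t = 2 *\<^sub>R (Re_part t * Re_part t + Im_part t * Im_part t)"
  proof -
    let ?x = "Re_part t" and ?y = "Im_part t"
    have xy: "self_adjoint ?x" "self_adjoint ?y"
      by (rule self_adjoint_Re_part self_adjoint_Im_part)+
    have "star t = ?x + \<i> *\<^sub>C (- ?y)"
      using xy arg_cong[OF Re_Im_part[of t, symmetric], of star]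
      by (simp add: star_add star_scaleC self_adjoint_def scaleC_minus_left scaleC_minus_right)
    then have "star (star t) * star t = ?x * ?x + ?y * ?y + \<i> *\<^sub>C (?x * - ?y - (- ?y) * ?x)"
      using star_mult_cartesian[OF xy(1) self_adjoint_minus[OF xy(2)]] by simp
    moreover have "star t * t = ?x * ?x + ?y * ?y + \<i> *\<^sub>C (?x * ?y - ?y * ?x)"
      using star_mult_cartesian[OF xy] by (simp add: Re_Im_part)
    ultimately show ?thesis
      by (simp add: star_star scaleR_2 scaleC_diff_right scaleC_add_right scaleC_minus_right)
  qed
  have "pos_element (star t * t + t * star t)"
    unfolding star_t scaleR_2
    by (intro pos_element_add pos_element_square self_adjoint_Re_part self_adjoint_Im_part)
  \<comment> \<open>Adding the positive element \<open>- (t * star t)\<close> leaves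
    \<open>star t * t\<close>, so this element and its negative are both positive.\<close>
  from pos_element_add[OF this pos_element_neg_mult_star[OF neg]] have "pos_element (star t * t)" by simp
  then have "star t * t = 0" using pos_element_antisym neg by blast
  then have "t = 0" by (simp add: star_mult_self_eq_0)
  then have "h * v = 0" by (simp add: h_def t_def mult.assoc)
  then have "g * v = 0" using hv by simp
  then have "v * v = 0" using \<open>h * v = 0\<close> by (simp add: v_def left_diff_distrib)
  then have "v = 0" using self_adjoint_square_eq_0[OF vsa] by blast
  then show ?thesis using g(1) by (simp add: v_def h_def)
qed

subsection \<open>States and maximal commutative subalgebras\<close>

lemma nonneg_Reals_iff_of_real: "z \<in> \<real>\<^sub>\<ge>\<^sub>0 \<longleftrightarrow> (\<exists>r\<ge>0. z = complex_of_real r)"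
  by (auto elim: nonneg_Reals_cases)

lemma Re_part_add: "Re_part (x + y) = Re_part x + Re_part y"
  by (simp add: Re_part_def star_add algebra_simps)

lemma Im_part_add: "Im_part (x + y) = Im_part x + Im_part y"
  by (simp add: Im_part_def star_add scaleC_add_right[symmetric] algebra_simps)

lemma Re_part_scaleR: "Re_part (r *\<^sub>R x) = r *\<^sub>R Re_part x"
  by (simp add: Re_part_def star_scaleR algebra_simps)

lemma Im_part_scaleR: "Im_part (r *\<^sub>R x) = r *\<^sub>R Im_part x"
  by (simp add: Im_part_def star_scaleR) (simp add: scaleR_scaleC scaleC_diff_right scaleC_scaleC mult.commute)

lemma Re_part_scaleC_i: "Re_part (\<i> *\<^sub>C x) = - Im_part x"
  by (simp add: Re_part_def Im_part_def star_scaleC scaleR_scaleC scaleC_diff_right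
      scaleC_add_right scaleC_scaleC scaleC_minus_left)

lemma Im_part_scaleC_i: "Im_part (\<i> *\<^sub>C x) = Re_part x"
  by (simp add: Re_part_def Im_part_def star_scaleC scaleR_scaleC scaleC_diff_right
      scaleC_add_right scaleC_scaleC scaleC_minus_left)

lemma Re_part_self_adjoint: "self_adjoint x \<Longrightarrow> Re_part x = x"
  by (simp add: Re_part_def self_adjoint_def scaleR_2[symmetric])

lemma Im_part_self_adjoint: "self_adjoint x \<Longrightarrow> Im_part x = 0"
  by (simp add: Im_part_def self_adjoint_def)

text \<open>The complex functional is assembled from the values of \<open>\<phi>\<close> on real and
  imaginary parts, which makes it real on self-adjoint elements by construction. Its positivity
  combines \<open>pos_element_star_mult\<close> with the bound by the norm.\<close>

lemma state_from_real_functional: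
  fixes \<phi> :: "'a::unital_cstar_algebra \<Rightarrow> real"
  assumes lin: "linear \<phi>" and le: "\<And>x. \<phi> x \<le> norm x" and one: "\<phi> 1 = 1"
  obtains \<rho> where "\<rho> \<in> states UNIV" "\<And>f. self_adjoint f \<Longrightarrow> \<rho> f = complex_of_real (\<phi> f)"
proof -
  interpret linear \<phi> by (rule lin)
  define \<rho> where "\<rho> x = Complex (\<phi> (Re_part x)) (\<phi> (Im_part x))" for x
  have sa: "\<rho> f = complex_of_real (\<phi> f)" if "self_adjoint f" for f
    using that by (simp add: \<rho>_def Re_part_self_adjoint Im_part_self_adjoint zero complex_of_real_def)
  have \<rho>_add: "\<rho> (x + y) = \<rho> x + \<rho> y" for x y
    by (simp add: \<rho>_def Re_part_add Im_part_add add complex_eq_iff)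
  have \<rho>_scaleR: "\<rho> (r *\<^sub>R x) = of_real r * \<rho> x" for r x
    by (simp add: \<rho>_def Re_part_scaleR Im_part_scaleR scale complex_eq_iff)
  have \<rho>_i: "\<rho> (\<i> *\<^sub>C x) = \<i> * \<rho> x" for x
    by (simp add: \<rho>_def Re_part_scaleC_i Im_part_scaleC_i neg complex_eq_iff)
  have \<rho>_scaleC: "\<rho> (c *\<^sub>C x) = c * \<rho> x" for c x
  proof -
    have "c *\<^sub>C x = Re c *\<^sub>R x + \<i> *\<^sub>C (Im c *\<^sub>R x)"
      by (simp add: scaleR_scaleC scaleC_scaleC scaleC_add_left[symmetric] flip: complex_eq)
    then have "\<rho> (c *\<^sub>C x) = (of_real (Re c) + \<i> * of_real (Im c)) * \<rho> x"
      by (simp add: \<rho>_add \<rho>_i \<rho>_scaleR algebra_simps)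
    then show ?thesis by (simp flip: complex_eq)
  qed
  have "\<rho> (star a * a) \<in> \<real>\<^sub>\<ge>\<^sub>0" for a
  proof -
    obtain s where s: "norm (s *\<^sub>R 1 - star a * a) \<le> s"
      using pos_element_star_mult[of a] by (auto simp: pos_element_def)
    have "s - \<phi> (star a * a) = \<phi> (s *\<^sub>R 1 - star a * a)" by (simp add: diff scale one)
    also have "\<dots> \<le> s" using le s order_trans by blast
    finally show ?thesis by (simp add: sa self_adjoint_star_mult)
  qed
  then have "\<rho> \<in> states UNIV"
    using sa[OF self_adjoint_one] by (simp add: states_def complex_linear_on_def \<rho>_add \<rho>_scaleC one)
  then show ?thesis using that sa by blast
qed

section \<open>States on a subalgebra\<close>

lemma unital_cstar_subalgebraD:
  assumes "unital_cstar_subalgebra B"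
  shows "1 \<in> B" "\<And>x y. x \<in> B \<Longrightarrow> y \<in> B \<Longrightarrow> x + y \<in> B"
    "\<And>x y. x \<in> B \<Longrightarrow> y \<in> B \<Longrightarrow> x * y \<in> B" "\<And>x c. x \<in> B \<Longrightarrow> c *\<^sub>C x \<in> B"
    "\<And>x r. x \<in> B \<Longrightarrow> r *\<^sub>R x \<in> B" "\<And>x. x \<in> B \<Longrightarrow> star x \<in> B"
  using assms by (auto simp: unital_cstar_subalgebra_def scaleR_scaleC)

text \<open>The element norm(f) 1 + f lies in the ball of radius norm(f) around norm(f) 1, so it is
  g^2 for a self-adjoint \<open>g\<close>. The root lies in \<open>B\<close>, the only place where
  \<open>\<mu>\<close> is known to be positive.\<close>

lemma state_norm_plus_nonneg:
  assumes B: "unital_cstar_subalgebra B" and \<mu>: "\<mu> \<in> states B"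
    and f: "f \<in> B" "self_adjoint f"
  shows "complex_of_real (norm f) + \<mu> f \<in> \<real>\<^sub>\<ge>\<^sub>0"
proof -
  note BD = unital_cstar_subalgebraD[OF B]
  have lin: "\<mu> (x + y) = \<mu> x + \<mu> y" "\<mu> (c *\<^sub>C x) = c * \<mu> x" if "x \<in> B" "y \<in> B" for x y c
    using \<mu> that by (auto simp: states_def complex_linear_on_def)
  have \<mu>1: "\<mu> 1 = 1" using \<mu> by (simp add: states_def)
  show ?thesis
  \<comment> \<open>For \<open>f = 0\<close> the radius would be 0, which \<open>sa_sqrt\<close>
    does not admit.\<close>
  proof (cases "f = 0")
    case True
    have "\<mu> (0 *\<^sub>C 1) = 0 * \<mu> 1" using lin(2) BD(1) by blast
    then show ?thesis using True scaleR_scaleC[of 0 "1::'a"] by simp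
  next
    case False
    let ?s = "norm f" and ?h = "norm f *\<^sub>R 1 + f"
    have s: "?s > 0" using False by simp
    have h: "norm (?s *\<^sub>R 1 - ?h) \<le> ?s" by simp
    have hB: "?h \<in> B" by (rule BD(2)[OF BD(5)[OF BD(1)] f(1)])
    have hsa: "self_adjoint ?h" using f by (intro self_adjoint_add self_adjoint_scaleR self_adjoint_one)
    define g where "g = sa_sqrt ?s ?h"
    have "g \<in> B" unfolding g_def by (rule sa_sqrt_in_subalgebra[OF s h B hB])
    moreover have "star g * g = ?h"
      using self_adjoint_sa_sqrt[OF s h hsa] sa_sqrt_square[OF s h] by (simp add: g_def self_adjoint_def)
    ultimately have "\<mu> ?h \<in> \<real>\<^sub>\<ge>\<^sub>0" using \<mu> by (auto simp: states_def)
    moreover have "\<mu> ?h = complex_of_real ?s + \<mu> f"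
      using lin(1)[of "?s *\<^sub>R 1" f] lin(2)[of 1 1 "complex_of_real ?s"] BD f \<mu>1
      by (simp add: scaleR_scaleC)
    ultimately show ?thesis by simp
  qed
qed

lemma state_real:
  assumes "unital_cstar_subalgebra B" "\<mu> \<in> states B" "f \<in> B" "self_adjoint f"
  shows "\<mu> f = complex_of_real (Re (\<mu> f))"
  using state_norm_plus_nonneg[OF assms] by (auto simp: nonneg_Reals_iff_of_real complex_eq_iff)

lemma state_le_norm:
  assumes B: "unital_cstar_subalgebra B" and \<mu>: "\<mu> \<in> states B" and f: "f \<in> B" "self_adjoint f"
  shows "Re (\<mu> f) \<le> norm f"
proof -
  have "(-1) *\<^sub>C f \<in> B" using f(1) unital_cstar_subalgebraD(4)[OF B] by blast
  then have "- f \<in> B" by (simp add: scaleC_minus_left)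
  moreover have "\<mu> ((-1) *\<^sub>C f) = - \<mu> f" using \<mu> f(1) by (auto simp: states_def complex_linear_on_def)
  then have "\<mu> (- f) = - \<mu> f" by (simp add: scaleC_minus_left)
  ultimately show ?thesis
    using state_norm_plus_nonneg[OF B \<mu>, of "- f"] self_adjoint_minus[OF f(2)]
    by (auto simp: nonneg_Reals_iff_of_real complex_eq_iff)
qed

text \<open>Contractivity of \<open>\<mu>\<close> at f + t 1 gives \<mu>(f) + t \<le> norm (f + t
  1), which is the condition for a global unital contractive functional with value at least \<mu>(f)
  at \<open>f\<close>.\<close>

lemma state_dominating:
  assumes B: "unital_cstar_subalgebra B" and \<mu>: "\<mu> \<in> states B" and f: "f \<in> B" "self_adjoint f"
  obtains \<rho> where "\<rho> \<in> states UNIV" "Re (\<mu> f) \<le> Re (\<rho> f)"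
proof -
  note BD = unital_cstar_subalgebraD[OF B]
  have "Re (\<mu> f) \<le> norm (f + t *\<^sub>R 1) - t" for t
  proof -
    have "\<mu> (f + complex_of_real t *\<^sub>C 1) = \<mu> f + complex_of_real t * \<mu> 1"
      using \<mu> f BD by (simp add: states_def complex_linear_on_def)
    then have "\<mu> (f + t *\<^sub>R 1) = \<mu> f + complex_of_real t"
      using \<mu> by (simp add: states_def scaleR_scaleC)
    moreover have "Re (\<mu> (f + t *\<^sub>R 1)) \<le> norm (f + t *\<^sub>R 1)"
      by (intro state_le_norm[OF B \<mu>] self_adjoint_add self_adjoint_scaleR self_adjoint_one BD f)
    ultimately show ?thesis by simp
  qed
  then obtain \<phi> where \<phi>: "linear \<phi>" "\<And>x. \<phi> x \<le> norm x" "\<phi> 1 = 1" "Re (\<mu> f) \<le> \<phi> f"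
    using unital_contractive_functional[of "Re (\<mu> f)" f] by metis
  obtain \<rho> where "\<rho> \<in> states UNIV" "\<And>f. self_adjoint f \<Longrightarrow> \<rho> f = complex_of_real (\<phi> f)"
    using state_from_real_functional[OF \<phi>(1-3)] by metis
  then show ?thesis using that \<phi>(4) f(2) by simp
qed

section \<open>Maximal commutative subalgebras\<close>

definition commutant :: "'a::unital_cstar_algebra set \<Rightarrow> 'a set" where
  "commutant M = {x. \<forall>y\<in>M. x * y = y * x}"

lemma unital_cstar_subalgebra_commutant:
  assumes "\<And>x. x \<in> M \<Longrightarrow> star x \<in> M"
  shows "unital_cstar_subalgebra (commutant M)"
proof -
  have "star x * y = y * star x" if "x \<in> commutant M" "y \<in> M" for x y
  proof -
    have "x * star y = star y * x" using that assms by (auto simp: commutant_def)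
    then have "star (x * star y) = star (star y * x)" by simp
    then show ?thesis by (simp add: star_mult star_star)
  qed
  moreover have "closed (commutant M)"
  proof -
    have "commutant M = (\<Inter>y\<in>M. {x. x * y = y * x})" by (auto simp: commutant_def)
    then show ?thesis by (auto intro!: closed_INT closed_Collect_eq continuous_intros)
  qed
  moreover have "x * y * z = z * (x * y)" if "x * z = z * x" "y * z = z * y" for x y z :: 'a
    by (metis that mult.assoc)
  ultimately show ?thesis
    unfolding unital_cstar_subalgebra_def
    by (auto simp: commutant_def distrib_left distrib_right mult_scaleC_left mult_scaleC_right)
qed

text \<open>A maximal commuting \<open>star\<close>-closed set equals its own commutant.\<close>

lemma maximal_subalgebra_containing:
  assumes f: "self_adjoint (f :: 'a::unital_cstar_algebra)"
  obtains B where "maximal_unital_comm_cstar_subalgebra B" "f \<in> B"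
proof -
  \<comment> \<open>Zorn's lemma runs over bare sets because a union of a chain of closed
    subalgebras need not be closed. The algebraic and topological closure properties come back at
    the end through the commutant.\<close>
  define S where "S = {M :: 'a set. f \<in> M \<and> (\<forall>x\<in>M. star x \<in> M) \<and> (\<forall>x\<in>M. \<forall>y\<in>M. x * y = y * x)}"
  have "\<exists>M\<in>S. \<forall>X\<in>S. M \<subseteq> X \<longrightarrow> X = M"
  proof (rule subset_Zorn_nonempty)
    have "{f} \<in> S" using f by (simp add: S_def self_adjoint_def)
    then show "S \<noteq> {}" by blast
  next
    fix \<C> assume \<C>: "\<C> \<noteq> {}" "subset.chain S \<C>"
    then have sub: "\<C> \<subseteq> S" and tot: "\<And>X Y. X \<in> \<C> \<Longrightarrow> Y \<in> \<C> \<Longrightarrow> X \<subseteq> Y \<or> Y \<subseteq> X"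
      by (auto simp: subset.chain_def)
    have "x * y = y * x" if xy: "x \<in> X" "X \<in> \<C>" "y \<in> Y" "Y \<in> \<C>" for x y X Y
    proof -
      obtain Z where "Z \<in> \<C>" "x \<in> Z" "y \<in> Z" using tot[OF xy(2,4)] xy by blast
      then show ?thesis using sub by (auto simp: S_def)
    qed
    moreover have "f \<in> \<Union>\<C>" using \<C>(1) sub by (auto simp: S_def)
    moreover have "\<forall>x\<in>\<Union>\<C>. star x \<in> \<Union>\<C>" using sub by (auto simp: S_def)
    ultimately show "\<Union>\<C> \<in> S" by (auto simp: S_def)
  qed
  then obtain M where MS: "M \<in> S" and max: "\<And>X. X \<in> S \<Longrightarrow> M \<subseteq> X \<Longrightarrow> X = M" by blast
  have M: "f \<in> M" "\<And>x. x \<in> M \<Longrightarrow> star x \<in> M" "\<And>x y. x \<in> M \<Longrightarrow> y \<in> M \<Longrightarrow> x * y = y * x"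
    using MS by (auto simp: S_def)
  have com: "unital_cstar_subalgebra (commutant M)"
    by (rule unital_cstar_subalgebra_commutant[OF M(2)])
  note D = unital_cstar_subalgebraD[OF com]
  have sa_in: "a \<in> M" if "a \<in> commutant M" "self_adjoint a" for a
  proof -
    have "insert a M \<in> S"
      using that M by (auto simp: S_def commutant_def self_adjoint_def)
    then show ?thesis using max[of "insert a M"] by blast
  qed
  have "x \<in> M" if x: "x \<in> commutant M" for x
  proof -
    have "Re_part x \<in> M"
      unfolding Re_part_def using D(5)[OF D(2)[OF x D(6)[OF x]]] self_adjoint_Re_part[of x]
      by (intro sa_in) (simp_all add: Re_part_def)
    moreover have "x + (-1) *\<^sub>C star x \<in> commutant M" by (rule D(2)[OF x D(4)[OF D(6)[OF x]]])
    then have "Im_part x \<in> commutant M" unfolding Im_part_def by (intro D(4)) (simp add: scaleC_minus_left)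
    then have "Im_part x \<in> M" by (intro sa_in self_adjoint_Im_part)
    ultimately have c: "Re_part x * Im_part x = Im_part x * Re_part x" using M(3) by blast
    \<comment> \<open>Adjoining \<open>x\<close> together with its adjoint keeps the set commuting
      only if \<open>x\<close> is normal; this holds because its real and imaginary parts already
      lie in \<open>M\<close>.\<close>
    have normal: "x * star x = star x * x"
    proof -
      have sx: "star x = Re_part x - \<i> *\<^sub>C Im_part x"
        using self_adjoint_Re_part[of x] self_adjoint_Im_part[of x]
          arg_cong[OF Re_Im_part[of x, symmetric], of star]
        by (simp add: star_add star_scaleC self_adjoint_def scaleC_minus_left)
      have "(Re_part x + \<i> *\<^sub>C Im_part x) * star x = star x * (Re_part x + \<i> *\<^sub>C Im_part x)"
        unfolding sx by (simp add: algebra_simps mult_scaleC_left mult_scaleC_right scaleC_diff_right scaleC_add_right c)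
      then show ?thesis by (simp add: Re_Im_part)
    qed
    have "star x \<in> commutant M" by (rule D(6)[OF x])
    then have "insert x (insert (star x) M) \<in> S"
      using x M normal by (auto simp: S_def commutant_def star_star)
    then show ?thesis using max[of "insert x (insert (star x) M)"] by blast
  qed
  then have eq: "commutant M = M" using M(3) by (auto simp: commutant_def)
  have "maximal_unital_comm_cstar_subalgebra M"
    unfolding maximal_unital_comm_cstar_subalgebra_def unital_comm_cstar_subalgebra_def
  proof (intro conjI allI impI)
    show "unital_cstar_subalgebra M" using com eq by simp
    show "\<forall>x\<in>M. \<forall>y\<in>M. x * y = y * x" using M(3) by blast
    fix C assume "(unital_cstar_subalgebra C \<and> (\<forall>x\<in>C. \<forall>y\<in>C. x * y = y * x)) \<and> M \<subseteq> C"
    then have "C \<subseteq> commutant M" "M \<subseteq> C" by (auto simp: commutant_def)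
    then show "C = M" using eq by simp
  qed
  then show ?thesis using that M(1) by blast
qed

section \<open>Comparison of the three diameters\<close>

lemma L_distI:
  assumes "f \<in> B" "self_adjoint f" "L f \<le> 1"
  shows "ennreal (cmod (\<mu> f - \<nu> f)) \<le> L_dist L B \<mu> \<nu>"
  unfolding L_dist_def using assms by (intro SUP_upper) simp

lemma L_diamI:
  assumes "\<mu> \<in> X" "\<nu> \<in> X" "f \<in> B" "self_adjoint f" "L f \<le> 1"
  shows "ennreal (cmod (\<mu> f - \<nu> f)) \<le> L_diam L B X"
  unfolding L_diam_def
  using L_distI[where L=L, OF assms(3-5)] by (intro SUP_upper2[OF assms(1)] SUP_upper2[OF assms(2)])

lemma L_diam_leI:
  assumes "\<And>\<mu> \<nu> f. \<mu> \<in> X \<Longrightarrow> \<nu> \<in> X \<Longrightarrow> f \<in> B \<Longrightarrow> self_adjoint f \<Longrightarrow> L f \<le> 1 \<Longrightarrow>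
    ennreal (cmod (\<mu> f - \<nu> f)) \<le> c"
  shows "L_diam L B X \<le> c"
  unfolding L_diam_def L_dist_def using assms by (auto intro!: SUP_least)

lemma L_diam_mono: "X \<subseteq> Y \<Longrightarrow> L_diam L B X \<le> L_diam L B Y"
  by (intro L_diam_leI L_diamI) auto

lemma states_UNIV_subset_quasi_states: "states UNIV \<subseteq> quasi_states"
  by (auto simp: states_def quasi_states_def complex_linear_on_def)

text \<open>Quasi-states are linear on \<open>B\<close> by definition; \<open>restrict\<close>
  supplies the value \<open>undefined\<close> outside \<open>B\<close> that membership in
  \<open>states B\<close> demands.\<close>

lemma restrict_quasi_state:
  assumes B: "unital_comm_cstar_subalgebra B" and \<mu>: "\<mu> \<in> quasi_states"
  shows "restrict \<mu> B \<in> states B"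
proof -
  have sub: "unital_cstar_subalgebra B" using B by (simp add: unital_comm_cstar_subalgebra_def)
  have "complex_linear_on B \<mu>" using B \<mu> by (simp add: quasi_states_def)
  then show ?thesis
    using \<mu> unital_cstar_subalgebraD[OF sub]
    by (simp add: states_def quasi_states_def complex_linear_on_def)
qed

text \<open>Dominating \<open>\<mu>\<close> at \<open>f\<close> and \<open>\<nu>\<close> at
  \<open>- f\<close> gives global states with \<sigma>(f) \<le> \<nu>(f) \<le> \<mu>(f) \<le>
  \<rho>(f). The values of \<open>\<mu>\<close> and \<open>\<nu>\<close> at \<open>f\<close> are
  real, so their distance is an ordinary difference.\<close>

lemma L_diam_states_le:
  assumes B: "unital_cstar_subalgebra B"
  shows "L_diam L B (states B) \<le> L_diam L UNIV (states UNIV)"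
proof -
  have *: "ennreal (cmod (\<mu> f - \<nu> f)) \<le> L_diam L UNIV (states UNIV)"
    if \<mu>: "\<mu> \<in> states B" and \<nu>: "\<nu> \<in> states B" and f: "f \<in> B" "self_adjoint f" "L f \<le> 1"
      and le: "Re (\<nu> f) \<le> Re (\<mu> f)" for \<mu> \<nu> f
  proof -
    note BD = unital_cstar_subalgebraD[OF B]
    obtain \<rho> where \<rho>: "\<rho> \<in> states UNIV" "Re (\<mu> f) \<le> Re (\<rho> f)"
      using state_dominating[OF B \<mu> f(1,2)] by metis
    have neg: "\<tau> (- f) = - \<tau> f" if "\<tau> \<in> states A" "f \<in> A" for \<tau> A
    proof -
      have "\<tau> ((-1) *\<^sub>C f) = (-1) * \<tau> f" using that by (auto simp: states_def complex_linear_on_def)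
      then show ?thesis by (simp add: scaleC_minus_left)
    qed
    have "- f \<in> B" using BD(4)[OF f(1), of "-1"] by (simp add: scaleC_minus_left)
    then obtain \<sigma> where \<sigma>: "\<sigma> \<in> states UNIV" "Re (\<nu> (- f)) \<le> Re (\<sigma> (- f))"
      using state_dominating[OF B \<nu>] self_adjoint_minus[OF f(2)] by metis
    then have "Re (\<sigma> f) \<le> Re (\<nu> f)" using neg[OF \<nu> f(1)] neg[OF \<sigma>(1)] by simp
    moreover have "\<mu> f - \<nu> f = complex_of_real (Re (\<mu> f) - Re (\<nu> f))"
      using state_real[OF B \<mu> f(1,2)] state_real[OF B \<nu> f(1,2)] by (metis of_real_diff)
    then have "cmod (\<mu> f - \<nu> f) = Re (\<mu> f) - Re (\<nu> f)" using le by (metis norm_of_real abs_of_nonneg diff_ge_0_iff_ge)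
    ultimately have "cmod (\<mu> f - \<nu> f) \<le> Re (\<rho> f - \<sigma> f)" using \<rho>(2) by simp
    also have "\<dots> \<le> cmod (\<rho> f - \<sigma> f)" by (rule complex_Re_le_cmod)
    finally have "ennreal (cmod (\<mu> f - \<nu> f)) \<le> ennreal (cmod (\<rho> f - \<sigma> f))"
      by (rule ennreal_leI)
    also have "\<dots> \<le> L_diam L UNIV (states UNIV)"
      using \<rho>(1) \<sigma>(1) f by (intro L_diamI) auto
    finally show ?thesis .
  qed
  show ?thesis
  proof (rule L_diam_leI)
    fix \<mu> \<nu> f
    assume "\<mu> \<in> states B" "\<nu> \<in> states B" "f \<in> B" "self_adjoint f" "L f \<le> 1"
    then show "ennreal (cmod (\<mu> f - \<nu> f)) \<le> L_diam L UNIV (states UNIV)"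
      using *[of \<mu> \<nu> f] *[of \<nu> \<mu> f] by (cases "Re (\<nu> f) \<le> Re (\<mu> f)") (auto simp: norm_minus_commute)
  qed
qed

lemma L_diam_quasi_states_le:
  "L_diam L UNIV quasi_states
    \<le> (SUP B\<in>{B :: 'a::unital_cstar_algebra set. maximal_unital_comm_cstar_subalgebra B}. L_diam L B (states B))"
proof (rule L_diam_leI)
  fix \<mu> \<nu> :: "'a \<Rightarrow> complex" and f :: 'a
  assume \<mu>: "\<mu> \<in> quasi_states" and \<nu>: "\<nu> \<in> quasi_states" and f: "self_adjoint f" "L f \<le> 1"
  obtain B where B: "maximal_unital_comm_cstar_subalgebra B" "f \<in> B"
    using maximal_subalgebra_containing[OF f(1)] by metis
  then have "unital_comm_cstar_subalgebra B" by (simp add: maximal_unital_comm_cstar_subalgebra_def)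
  then have "ennreal (cmod (restrict \<mu> B f - restrict \<nu> B f)) \<le> L_diam L B (states B)"
    by (intro L_diamI restrict_quasi_state \<mu> \<nu> B f)
  then show "ennreal (cmod (\<mu> f - \<nu> f))
      \<le> (SUP B\<in>{B. maximal_unital_comm_cstar_subalgebra B}. L_diam L B (states B))"
    using B by (intro SUP_upper2[of B]) auto
qed

theorem proposition5p12:
  fixes L :: "'a::unital_cstar_algebra \<Rightarrow> ennreal"
  assumes "partially_defined_L_seminorm L"
  shows "(SUP B\<in>{B :: 'a set. maximal_unital_comm_cstar_subalgebra B}. L_diam L B (states B))
           = L_diam L UNIV (states UNIV)
       \<and> L_diam L UNIV (states UNIV) = L_diam L UNIV quasi_states"
proof -
  have "(SUP B\<in>{B :: 'a set. maximal_unital_comm_cstar_subalgebra B}. L_diam L B (states B))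
      \<le> L_diam L UNIV (states UNIV)"
    by (intro SUP_least L_diam_states_le)
      (simp add: maximal_unital_comm_cstar_subalgebra_def unital_comm_cstar_subalgebra_def)
  moreover have "L_diam L UNIV (states UNIV) \<le> L_diam L UNIV quasi_states"
    by (rule L_diam_mono[OF states_UNIV_subset_quasi_states])
  \<comment> \<open>The three inequalities form a cycle, so all three quantities agree.\<close>
  ultimately show ?thesis using L_diam_quasi_states_le[of L] by (meson order_antisym order_trans)
qed

end
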